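(* There is no integer $d$ with the following property: for every bipartite graph $G$ with bipartition $(A,B)$ that is $1$-nested on $(A,B)$, there is a half-graph $H$ with the same bipartition $(A,B)$ such that the bipartite local difference between $G$ and $H$ is at most $d$. (Consequently, there is no function $f$ such that for all integers $t\ge 0$, every bipartite graph $G$ that is $t$-nested on its bipartition $(A,B)$ has bipartite local difference at most $f(t)$ from some half-graph with bipartition $(A,B)$.)
   Context: All graphs are finite and have no loops or parallel edges. Let $G$ be a bipartite graph with bipartition $(A,B)$. $G$ is $t$-nested on $(A,B)$ if for all distinct $u,v\in B$, one of $u,v$ has at most $t$ neighbours that are nonadjacent to the other. A half-graph is a bipartite graph with bipartition $(X,Y)$ such that $X,Y$ can be ordered as $X=\{x_1,\ldots,x_m\}$ and $Y=\{y_1,\ldots,y_n\}$ so that for all $1\le i\le i'\le m$ and $1\le j\le j'\le n$, if $x_iy_j$ is an edge then $x_{i'}y_{j'}$ is an edge; equivalently, a bipartite graph that is $0$-nested on $(X,Y)$. If $G,H$ are both bipartite graphs with bipartition $(A,B)$, the bipartite local difference between $G$ and $H$ is the maximum over $v\in B$ of $|N_G(v)\setminus N_H(v)|+|N_H(v)\setminus N_G(v)|$, where $N_G(v),N_H(v)$ are the sets of neighbours of $v$ in $G,H$ (note that the maximum is only over $v\in B$, not $v\in A$). *)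

theory Defs
  imports Complex_Main "Graph_Theory.Pair_Digraph"
begin

(* Finite simple graphs are the library's pair_graph: finite, loopless, symmetric sets of
   vertex pairs. An edge uv is present as both (u, v) and (v, u). *)

definition bipartite_graph :: "'a pair_pre_digraph \<Rightarrow> 'a set \<Rightarrow> 'a set \<Rightarrow> bool" where
  "bipartite_graph G A B \<longleftrightarrow>
     pair_graph G \<and> pverts G = A \<union> B \<and> A \<inter> B = {} \<and>
     parcs G \<subseteq> A \<times> B \<union> B \<times> A"

definition nbrs :: "'a pair_pre_digraph \<Rightarrow> 'a \<Rightarrow> 'a set" where
  "nbrs G v = {u. (v, u) \<in> parcs G}"

definition nested :: "nat \<Rightarrow> 'a pair_pre_digraph \<Rightarrow> 'a set \<Rightarrow> 'a set \<Rightarrow> bool" where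
  "nested t G A B \<longleftrightarrow>
     bipartite_graph G A B \<and>
     (\<forall>u\<in>B. \<forall>v\<in>B. u \<noteq> v \<longrightarrow>
        card (nbrs G u - nbrs G v) \<le> t \<or> card (nbrs G v - nbrs G u) \<le> t)"

(* The orderings of X and Y are duplicate-free lists. *)
definition half_graph :: "'a pair_pre_digraph \<Rightarrow> 'a set \<Rightarrow> 'a set \<Rightarrow> bool" where
  "half_graph H X Y \<longleftrightarrow>
     bipartite_graph H X Y \<and>
     (\<exists>xs ys. distinct xs \<and> set xs = X \<and> distinct ys \<and> set ys = Y \<and>
        (\<forall>i i' j j'. i \<le> i' \<and> i' < length xs \<and> j \<le> j' \<and> j' < length ys \<and>
           (xs ! i, ys ! j) \<in> parcs H \<longrightarrow> (xs ! i', ys ! j') \<in> parcs H))"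

(* The inserted 0 only matters for empty B, where it fixes the value of the maximum. *)
definition bip_local_diff ::
    "'a pair_pre_digraph \<Rightarrow> 'a pair_pre_digraph \<Rightarrow> 'a set \<Rightarrow> nat" where
  "bip_local_diff G H B =
     Max (insert 0 ((\<lambda>v. card (nbrs G v - nbrs H v) + card (nbrs H v - nbrs G v)) ` B))"

end

(* The neighbour sets of B below are indexed by the leaves of a complete binary tree, ordered from
   left to right. An inner node of the tree is an element of the sets of the leaves in its left
   subtree and of the leaves to the right of its whole subtree. If i < j are leaves, then only their
   lowest common ancestor lies in the set of i and not in that of j, so the family is 1-nested. For
   an increasing chain of sets, each inner node is misplaced either at all leaves of its left subtree
   or at all leaves of its right subtree. Descending from the root into the bad side each time ends
   at a leaf where every ancestor is misplaced. Enough further elements, each added from some leaf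
   onwards, force any close chain to increase from left to right. *)
theory Submission
  imports Defs
begin

text \<open>The ordering condition with \<open>i = i'\<close> makes the neighbour sets increase
  along the list \<open>ys\<close>.\<close>

lemma half_graph_nbrs_chain:
  assumes "half_graph H A B" "u \<in> B" "v \<in> B"
  shows "nbrs H u \<subseteq> nbrs H v \<or> nbrs H v \<subseteq> nbrs H u"
proof -
  from assms(1) obtain xs ys where bip: "bipartite_graph H A B"
    and xs: "set xs = A" and ys: "set ys = B"
    and mono: "\<And>i i' j j'. \<lbrakk>i \<le> i'; i' < length xs; j \<le> j'; j' < length ys;
        (xs ! i, ys ! j) \<in> parcs H\<rbrakk> \<Longrightarrow> (xs ! i', ys ! j') \<in> parcs H"
    unfolding half_graph_def by blast
  have "pair_graph H"
    using bip by (simp add: bipartite_graph_def)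
  then interpret pair_graph H .
  have sym: "(y, x) \<in> parcs H" if "(x, y) \<in> parcs H" for x y
    using that arcs_symmetric by blast
  have sub: "nbrs H (ys ! j) \<subseteq> nbrs H (ys ! j')" if j: "j \<le> j'" "j' < length ys" for j j'
  proof
    fix x assume "x \<in> nbrs H (ys ! j)"
    then have e: "(ys ! j, x) \<in> parcs H" by (simp add: nbrs_def)
    have "ys ! j \<in> B" using j ys nth_mem[of j ys] by simp
    then have "x \<in> A" using e bip unfolding bipartite_graph_def by blast
    then obtain i where i: "i < length xs" "x = xs ! i" using xs by (metis in_set_conv_nth)
    have "(xs ! i, ys ! j') \<in> parcs H" using mono[of i i j j'] i j sym[OF e] by simp
    then show "x \<in> nbrs H (ys ! j')" using sym i by (simp add: nbrs_def)
  qed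
  obtain j j' where "u = ys ! j" "j < length ys" "v = ys ! j'" "j' < length ys"
    using assms(2,3) ys by (metis in_set_conv_nth)
  then show ?thesis using sub by (metis nat_le_linear)
qed

lemma bip_local_diff_ge:
  assumes "finite B" "v \<in> B"
  shows "card (nbrs G v - nbrs H v) + card (nbrs H v - nbrs G v) \<le> bip_local_diff G H B"
  unfolding bip_local_diff_def using assms by (intro Max_ge) auto

text \<open>The theorem concerns graphs on natural numbers, so indices and elements are encoded by
  \<open>to_nat\<close>; the tags \<open>Inl\<close> and \<open>Inr\<close> keep the two sides
  disjoint.\<close>

definition incidence_graph :: "'b::countable set \<Rightarrow> 'e::countable set \<Rightarrow> ('b \<Rightarrow> 'e set) \<Rightarrow> nat pair_pre_digraph" where
  "incidence_graph I E V =
     (let b = (\<lambda>v. to_nat (Inl v :: 'b + 'e)); a = (\<lambda>e. to_nat (Inr e :: 'b + 'e)) in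
      \<lparr>pverts = a ` E \<union> b ` I,
       parcs = {(b v, a e) |v e. v \<in> I \<and> e \<in> V v} \<union> {(a e, b v) |v e. v \<in> I \<and> e \<in> V v}\<rparr>)"

lemma
  fixes I :: "'b::countable set" and E :: "'e::countable set"
  defines "b \<equiv> \<lambda>v. to_nat (Inl v :: 'b + 'e)" and "a \<equiv> \<lambda>e. to_nat (Inr e :: 'b + 'e)"
  assumes fin: "finite I" "finite E" and V: "\<And>v. v \<in> I \<Longrightarrow> V v \<subseteq> E"
  shows bipartite_incidence_graph: "bipartite_graph (incidence_graph I E V) (a ` E) (b ` I)"
    and nbrs_incidence_graph: "v \<in> I \<Longrightarrow> nbrs (incidence_graph I E V) (b v) = a ` V v"
proof -
  let ?G = "incidence_graph I E V"
  have ab: "a e \<noteq> b w" "b w \<noteq> a e" for e w by (simp_all add: a_def b_def)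
  have inj: "b w = b w' \<longleftrightarrow> w = w'" for w w' by (simp add: b_def)
  have arcs: "parcs ?G = {(b v, a e) |v e. v \<in> I \<and> e \<in> V v} \<union> {(a e, b v) |v e. v \<in> I \<and> e \<in> V v}"
    and verts: "pverts ?G = a ` E \<union> b ` I"
    by (simp_all add: incidence_graph_def a_def b_def Let_def)
  have sub: "parcs ?G \<subseteq> a ` E \<times> b ` I \<union> b ` I \<times> a ` E"
    using V unfolding arcs by blast
  have "finite (parcs ?G)"
    by (rule finite_subset[OF sub]) (use fin in simp)
  then have "pair_graph ?G"
    using fin ab
    by unfold_locales (auto simp: verts arcs symmetric_def sym_def dest: subsetD[OF V])
  then show "bipartite_graph ?G (a ` E) (b ` I)"
    using sub ab unfolding bipartite_graph_def verts by auto
  show "v \<in> I \<Longrightarrow> nbrs ?G (b v) = a ` V v"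
    unfolding nbrs_def arcs using ab inj by auto
qed

text \<open>Passes from graphs to set families: \<open>near\<close> is applied to the incidence
  graph of \<open>V\<close>, and \<open>C\<close> is read off from the neighbour sets of the
  resulting half-graph.\<close>

lemma chain_near_nested_family:
  fixes I :: "'b::countable set" and V :: "'b \<Rightarrow> 'e::countable set"
  assumes fin: "finite I" "\<And>v. v \<in> I \<Longrightarrow> finite (V v)"
    and nest: "\<And>u v. \<lbrakk>u \<in> I; v \<in> I\<rbrakk> \<Longrightarrow> card (V u - V v) \<le> t \<or> card (V v - V u) \<le> t"
    and near: "\<And>(G::nat pair_pre_digraph) A B. nested t G A B \<Longrightarrow>
                 \<exists>H. half_graph H A B \<and> bip_local_diff G H B \<le> d"
  obtains C where "\<And>u v. \<lbrakk>u \<in> I; v \<in> I\<rbrakk> \<Longrightarrow> C u \<subseteq> C v \<or> C v \<subseteq> C u"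
    and "\<And>v. v \<in> I \<Longrightarrow> finite (C v)"
    and "\<And>v. v \<in> I \<Longrightarrow> card (V v - C v) + card (C v - V v) \<le> d"
proof -
  define E where "E = \<Union> (V ` I)"
  define b where "b = (\<lambda>v. to_nat (Inl v :: 'b + 'e))"
  define a where "a = (\<lambda>e. to_nat (Inr e :: 'b + 'e))"
  define G where "G = incidence_graph I E V"
  have E: "finite E" "\<And>v. v \<in> I \<Longrightarrow> V v \<subseteq> E" using fin by (auto simp: E_def)
  have bip: "bipartite_graph G (a ` E) (b ` I)"
    unfolding G_def a_def b_def by (rule bipartite_incidence_graph) (use fin E in auto)
  have nb: "nbrs G (b v) = a ` V v" if "v \<in> I" for v
    unfolding G_def a_def b_def by (rule nbrs_incidence_graph) (use fin E that in auto)
  have inj: "inj a" by (auto simp: a_def inj_def)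
  have card_a: "card (a ` X) = card X" for X
    by (rule card_image[OF inj_on_subset[OF inj]]) simp
  have "nested t G (a ` E) (b ` I)"
    unfolding nested_def using bip nest
    by (auto simp: nb image_set_diff[OF inj, symmetric] card_a)
  from near[OF this] obtain H
    where H: "half_graph H (a ` E) (b ` I)" and diff: "bip_local_diff G H (b ` I) \<le> d" by blast
  define C where "C v = a -` nbrs H (b v)" for v
  have nbH: "nbrs H (b v) = a ` C v \<and> C v \<subseteq> E" if "v \<in> I" for v
  proof -
    have "parcs H \<subseteq> a ` E \<times> b ` I \<union> b ` I \<times> a ` E"
      using H by (simp add: half_graph_def bipartite_graph_def)
    moreover have "b v \<notin> a ` E" by (auto simp: a_def b_def)
    ultimately have "nbrs H (b v) \<subseteq> a ` E" by (auto simp: nbrs_def)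
    then show ?thesis using inj by (auto simp: C_def inj_def)
  qed
  show thesis
  proof
    show "C u \<subseteq> C v \<or> C v \<subseteq> C u" if "u \<in> I" "v \<in> I" for u v
      using half_graph_nbrs_chain[OF H, of "b u" "b v"] that unfolding C_def by blast
    show "finite (C v)" if "v \<in> I" for v
      using nbH[OF that] E(1) by (meson finite_subset)
    show "card (V v - C v) + card (C v - V v) \<le> d" if "v \<in> I" for v
    proof -
      have "card (nbrs G (b v) - nbrs H (b v)) + card (nbrs H (b v) - nbrs G (b v)) \<le> d"
        using bip_local_diff_ge[of "b ` I" "b v" G H] diff fin that by force
      then show ?thesis
        using that by (simp add: nb nbH image_set_diff[OF inj, symmetric] card_a)
    qed
  qed
qed

(* Inl (k, m) is the inner node whose subtree consists of the leaves v with v div 2 ^ Suc k = m;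
   its left subtree is given by v div 2 ^ k = 2 * m. The elements Inr (j, c) with c < p are the
   p elements added at leaf j. *)
definition tree_family :: "nat \<Rightarrow> nat \<Rightarrow> nat \<Rightarrow> (nat \<times> nat + nat \<times> nat) set" where
  "tree_family n p v =
     {Inl (k, m) |k m. k < n \<and> 2 * m \<le> v div 2 ^ k \<and> v div 2 ^ k \<noteq> 2 * m + 1} \<union>
     {Inr (j, c) |j c. j \<le> v \<and> c < p}"

lemma finite_tree_family: "finite (tree_family n p v)"
proof (rule finite_subset)
  have "m \<le> v" if "2 * m \<le> v div 2 ^ k" for k m
    using that div_le_dividend[of v "2 ^ k"] by linarith
  then show "tree_family n p v \<subseteq> Inl ` ({..<n} \<times> {..v}) \<union> Inr ` ({..v} \<times> {..<p})"
    unfolding tree_family_def by auto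
qed simp

text \<open>Elements tagged \<open>Inr\<close> are never lost from left to right. For an inner node,
  the quotient at \<open>i\<close> is at least \<open>2 * m\<close>, hence so is the one at
  \<open>j\<close>; the node can be absent at \<open>j\<close> only if that quotient is
  \<open>2 * m + 1\<close>, which leaves \<open>2 * m\<close> for \<open>i\<close>.\<close>

lemma tree_family_diff:
  assumes "i \<le> j" "e \<in> tree_family n p i - tree_family n p j"
  obtains k m where "e = Inl (k, m)" "i div 2 ^ k = 2 * m" "j div 2 ^ k = 2 * m + 1"
proof -
  have le: "i div 2 ^ k \<le> j div 2 ^ k" for k using assms(1) by (rule div_le_mono)
  obtain k m where e: "e = Inl (k, m)" "k < n" "2 * m \<le> i div 2 ^ k" "i div 2 ^ k \<noteq> 2 * m + 1"
    using assms unfolding tree_family_def by (auto dest: le_trans)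
  then have "j div 2 ^ k = 2 * m + 1"
    using assms(2) le[of k] unfolding tree_family_def by auto
  with e le[of k] that show thesis by (metis Suc_eq_plus1 le_SucE le_antisym)
qed

text \<open>Halving sends \<open>2 * m\<close> and \<open>2 * m + 1\<close> both to
  \<open>m\<close>, so the quotients of \<open>i\<close> and \<open>j\<close> agree at all levels
  above \<open>k\<close>, while at \<open>l\<close> they differ; the same holds with
  \<open>k\<close> and \<open>l\<close> exchanged.\<close>

lemma sibling_level_unique:
  fixes i j :: nat
  assumes "i div 2 ^ k = 2 * m" "j div 2 ^ k = 2 * m + 1"
    and "i div 2 ^ l = 2 * m'" "j div 2 ^ l = 2 * m' + 1"
  shows "k = l"
proof -
  have *: False if "k < l" "i div 2 ^ k = 2 * m" "j div 2 ^ k = 2 * m + 1"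
    "i div 2 ^ l \<noteq> j div 2 ^ l" for k l m
  proof -
    from \<open>k < l\<close> obtain r where r: "l = k + Suc r" by (auto simp: less_iff_Suc_add)
    have "x div 2 ^ l = x div 2 ^ k div 2 div 2 ^ r" for x :: nat
      by (simp only: r power_add power_Suc div_mult2_eq)
    then show False using that by simp
  qed
  show ?thesis using *[of k l m] *[of l k m'] assms by (metis linorder_neqE_nat n_not_Suc_n Suc_eq_plus1)
qed

lemma card_tree_family_diff:
  assumes "i \<le> j"
  shows "card (tree_family n p i - tree_family n p j) \<le> 1"
proof -
  have "e = e'" if "e \<in> tree_family n p i - tree_family n p j"
    "e' \<in> tree_family n p i - tree_family n p j" for e e'
    using tree_family_diff[OF assms that(1)] tree_family_diff[OF assms that(2)] sibling_level_unique
    by (metis nat_mult_eq_cancel1 zero_less_numeral)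
  then show ?thesis
    using finite_tree_family by (simp add: card_le_Suc0_iff_eq)
qed

lemma chain_near_tree_family_mono:
  assumes "i < j" and fin: "finite (C i)" "finite (C j)"
    and chain: "C i \<subseteq> C j \<or> C j \<subseteq> C i"
    and "card (tree_family n p j - C j) + card (C i - tree_family n p i) < p"
  shows "C i \<subseteq> C j"
proof (rule ccontr)
  assume "\<not> C i \<subseteq> C j"
  with chain have sub: "C j \<subseteq> C i" by blast
  let ?P = "(\<lambda>c. Inr (j, c) :: nat \<times> nat + nat \<times> nat) ` {..<p}"
  have "?P \<subseteq> (tree_family n p j - C j) \<union> (C i - tree_family n p i)"
    using assms(1) sub by (auto simp: tree_family_def)
  then have "card ?P \<le> card ((tree_family n p j - C j) \<union> (C i - tree_family n p i))"
    using fin finite_tree_family by (intro card_mono) auto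
  also have "\<dots> \<le> card (tree_family n p j - C j) + card (C i - tree_family n p i)"
    by (rule card_Un_le)
  also have "card ?P = p" by (subst card_image) (auto simp: inj_on_def)
  finally show False using assms(5) by simp
qed

text \<open>The descent, as an induction on the height \<open>k\<close> of the subtree whose leaves
  are the \<open>v\<close> with \<open>v div 2 ^ k = m\<close>. The bound on \<open>m\<close> keeps
  these leaves below \<open>2 ^ n\<close>, where \<open>C\<close> is increasing. The ancestor of
  \<open>v\<close> at height \<open>l + 1\<close> is
  \<open>Inl (l, v div 2 ^ Suc l)\<close>.\<close>

lemma misplaced_path:
  assumes mono: "\<And>i j. \<lbrakk>i < j; j < 2 ^ n\<rbrakk> \<Longrightarrow> C i \<subseteq> C j"
    and "k \<le> n" "(m + 1) * 2 ^ k \<le> (2::nat) ^ n"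
  shows "\<exists>v. v div 2 ^ k = m \<and>
           (\<forall>l<k. Inl (l, v div 2 ^ Suc l) \<in> (tree_family n p v - C v) \<union> (C v - tree_family n p v))"
  using assms(2,3)
proof (induction k arbitrary: m)
  case 0
  show ?case by simp
next
  case (Suc k)
  let ?D = "\<lambda>v. (tree_family n p v - C v) \<union> (C v - tree_family n p v)"
  let ?a = "Inl (k, m)"
  have bound: "v < 2 ^ n" if "v div 2 ^ k \<le> 2 * m + 1" for v
  proof -
    have "v div 2 ^ k < 2 * m + 2" using that by simp
    then have "v < (2 * m + 2) * 2 ^ k" by (subst (asm) div_less_iff_less_mult) simp_all
    then show ?thesis using Suc.prems(2) by (simp add: algebra_simps)
  qed
  have left: "?a \<in> tree_family n p v" if "v div 2 ^ k = 2 * m" for v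
    using that Suc.prems(1) by (simp add: tree_family_def)
  have right: "?a \<notin> tree_family n p v" if "v div 2 ^ k = 2 * m + 1" for v
    using that by (simp add: tree_family_def)
  \<comment> \<open>If \<open>?a\<close> were correctly placed at a left leaf \<open>i\<close> and
    at a right leaf \<open>j\<close>, it would lie in \<open>C i\<close> but not in
    \<open>C j\<close>, although \<open>i < j\<close>.\<close>
  have "(\<forall>v. v div 2 ^ k = 2 * m \<longrightarrow> ?a \<in> ?D v) \<or> (\<forall>v. v div 2 ^ k = 2 * m + 1 \<longrightarrow> ?a \<in> ?D v)"
  proof (rule ccontr)
    assume "\<not> ?thesis"
    then obtain i j where i: "i div 2 ^ k = 2 * m" "?a \<notin> ?D i"
      and j: "j div 2 ^ k = 2 * m + 1" "?a \<notin> ?D j" by blast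
    have "i < j" using i(1) j(1) div_le_mono[of j i "2 ^ k"] by linarith
    then have "C i \<subseteq> C j" using mono bound j(1) by simp
    then show False using i j left[of i] right[of j] by blast
  qed
  then obtain m' where "m' = 2 * m \<or> m' = 2 * m + 1"
    and bad: "\<And>v. v div 2 ^ k = m' \<Longrightarrow> ?a \<in> ?D v" by blast
  then have m': "m' div 2 = m" "m' \<le> 2 * m + 1" by auto
  have "(m' + 1) * 2 ^ k \<le> (2 * m + 2) * 2 ^ k" using m'(2) by (intro mult_right_mono) auto
  then have "(m' + 1) * 2 ^ k \<le> 2 ^ n" using Suc.prems(2) by (simp add: algebra_simps)
  with Suc.IH[of m'] Suc.prems(1) obtain v
    where v: "v div 2 ^ k = m'" "\<forall>l<k. Inl (l, v div 2 ^ Suc l) \<in> ?D v" by auto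
  have m: "v div 2 ^ Suc k = m" using v(1) m'(1) by (metis div_mult2_eq power_Suc2)
  \<comment> \<open>Levels below \<open>k\<close> come from the induction hypothesis for the bad
    child \<open>m'\<close>; at \<open>l = k\<close> the node is \<open>?a\<close>.\<close>
  have "\<forall>l<Suc k. Inl (l, v div 2 ^ Suc l) \<in> ?D v"
    using v bad m by (metis less_antisym)
  with m show ?case by blast
qed

lemma nested_1_not_near_half_graph:
  "\<exists>(G::nat pair_pre_digraph) A B. nested 1 G A B \<and>
     (\<forall>H. half_graph H A B \<longrightarrow> d < bip_local_diff G H B)"
proof (rule ccontr)
  assume "\<not> ?thesis"
  then have near: "\<And>(G::nat pair_pre_digraph) A B. nested 1 G A B \<Longrightarrow>
      \<exists>H. half_graph H A B \<and> bip_local_diff G H B \<le> d"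
    by (meson linorder_not_le)
  \<comment> \<open>A path of \<open>d + 1\<close> misplaced nodes exceeds the error allowed at its
    leaf. Two leaves together have error at most \<open>2 * d\<close>, so \<open>2 * d + 1\<close>
    elements per leaf force \<open>C\<close> to increase.\<close>
  define n p where "n = d + 1" and "p = 2 * d + 1"
  let ?V = "tree_family n p"
  have nest: "card (?V u - ?V v) \<le> 1 \<or> card (?V v - ?V u) \<le> 1" for u v
    using card_tree_family_diff by (metis nat_le_linear)
  obtain C where chain: "\<And>u v. \<lbrakk>u \<in> {..<2 ^ n}; v \<in> {..<2 ^ n}\<rbrakk> \<Longrightarrow> C u \<subseteq> C v \<or> C v \<subseteq> C u"
    and fin: "\<And>v. v \<in> {..<2 ^ n} \<Longrightarrow> finite (C v)"
    and dist: "\<And>v. v \<in> {..<2 ^ n} \<Longrightarrow> card (?V v - C v) + card (C v - ?V v) \<le> d"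
    by (rule chain_near_nested_family[of "{..<2 ^ n}" ?V 1 d])
      (use nest near finite_tree_family in auto)
  have mono: "C i \<subseteq> C j" if "i < j" "j < 2 ^ n" for i j
  proof (rule chain_near_tree_family_mono)
    show "card (?V j - C j) + card (C i - ?V i) < p"
      using dist[of i] dist[of j] that by (simp add: p_def)
  qed (use that chain fin in auto)
  obtain v where v: "v div 2 ^ n = 0"
    and bad: "\<forall>l<n. Inl (l, v div 2 ^ Suc l) \<in> (?V v - C v) \<union> (C v - ?V v)"
    using misplaced_path[of n C n 0 p] mono by auto
  have vn: "v \<in> {..<2 ^ n}" using v by (simp add: div_eq_0_iff)
  have "n = card ((\<lambda>l. Inl (l, v div 2 ^ Suc l) :: nat \<times> nat + nat \<times> nat) ` {..<n})"
    by (subst card_image) (auto simp: inj_on_def)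
  also have "\<dots> \<le> card ((?V v - C v) \<union> (C v - ?V v))"
    using bad fin[OF vn] finite_tree_family by (intro card_mono) auto
  also have "\<dots> \<le> d" using card_Un_le dist[OF vn] by (rule le_trans)
  finally show False by (simp add: n_def)
qed

theorem mainTheorem2:
  shows "(\<nexists>d::int. \<forall>(G::nat pair_pre_digraph) A B.
            nested 1 G A B \<longrightarrow>
              (\<exists>H. half_graph H A B \<and> int (bip_local_diff G H B) \<le> d))
       \<and> (\<nexists>f::nat \<Rightarrow> real. \<forall>t. \<forall>(G::nat pair_pre_digraph) A B.
            nested t G A B \<longrightarrow>
              (\<exists>H. half_graph H A B \<and> real (bip_local_diff G H B) \<le> f t))"
proof (intro conjI notI; elim exE)
  fix d :: int
  assume *: "\<forall>(G::nat pair_pre_digraph) A B. nested 1 G A B \<longrightarrow>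
              (\<exists>H. half_graph H A B \<and> int (bip_local_diff G H B) \<le> d)"
  \<comment> \<open>For negative \<open>d\<close> the value \<open>nat d\<close> is 0, so it is at
    least \<open>d\<close> in every case.\<close>
  obtain G :: "nat pair_pre_digraph" and A B where "nested 1 G A B"
    "\<And>H. half_graph H A B \<Longrightarrow> nat d < bip_local_diff G H B"
    using nested_1_not_near_half_graph[of "nat d"] by blast
  with * show False by fastforce
next
  fix f :: "nat \<Rightarrow> real"
  assume *: "\<forall>t. \<forall>(G::nat pair_pre_digraph) A B. nested t G A B \<longrightarrow>
              (\<exists>H. half_graph H A B \<and> real (bip_local_diff G H B) \<le> f t)"
  \<comment> \<open>The contradiction arises at \<open>t = 1\<close>; the bound
    \<open>nat \<lceil>f 1\<rceil>\<close> is at least \<open>f 1\<close>, whatever its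
    sign.\<close>
  obtain G :: "nat pair_pre_digraph" and A B where "nested 1 G A B"
    and far: "\<And>H. half_graph H A B \<Longrightarrow> nat \<lceil>f 1\<rceil> < bip_local_diff G H B"
    using nested_1_not_near_half_graph[of "nat \<lceil>f 1\<rceil>"] by blast
  with * obtain H where "half_graph H A B" "real (bip_local_diff G H B) \<le> f 1" by blast
  with far[of H] show False by linarith
qed

end
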